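(* Let $X$ be an infinite dimensional normed vector space and let $Y$ be a separable Banach space containing an isomorphic copy of $c_0$. Then $\widetilde{\mathcal A}(X,Y)=\emptyset$.
   Context: $c_0$ denotes the space of all real sequences converging to $0$, equipped with the supremum norm. For metric spaces $(X,d)$, $(Y,\varrho)$, $\alpha\in(0,1]$ and $K>0$, a map $f:X\to Y$ is called $(K,\alpha)$-Hölder if $\varrho(f(x),f(y))\le K d(x,y)^\alpha$ for all $x,y\in X$. For $C\ge 1$, $\mathcal B_C(X,Y)$ denotes the set of all $\alpha\in(0,1]$ such that for every $K>0$ and every subset $M\subset X$, any $(K,\alpha)$-Hölder function $f:M\to Y$ can be extended to a $(CK,\alpha)$-Hölder function from $X$ into $Y$. Set $\widetilde{\mathcal A}(X,Y)=\bigcap_{C>1}\mathcal B_C(X,Y)$. Normed spaces are viewed as metric spaces with the norm distance. *)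

theory Defs
  imports "HOL-Analysis.Analysis"
begin

typedef c0 = "{x :: nat \<Rightarrow> real. x \<longlonglongrightarrow> 0}"
  by (rule exI[of _ "\<lambda>_. 0"]) simp

setup_lifting type_definition_c0

instantiation c0 :: real_vector
begin

lift_definition zero_c0 :: c0 is "\<lambda>_. 0"
  by simp

lift_definition plus_c0 :: "c0 \<Rightarrow> c0 \<Rightarrow> c0" is "\<lambda>x y n. x n + y n"
  using tendsto_add by fastforce

lift_definition minus_c0 :: "c0 \<Rightarrow> c0 \<Rightarrow> c0" is "\<lambda>x y n. x n - y n"
  using tendsto_diff by fastforce

lift_definition uminus_c0 :: "c0 \<Rightarrow> c0" is "\<lambda>x n. - x n"
  using tendsto_minus by fastforce

lift_definition scaleR_c0 :: "real \<Rightarrow> c0 \<Rightarrow> c0" is "\<lambda>r x n. r * x n"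
  using tendsto_mult_right_zero by blast

instance
  by standard (transfer; auto simp: algebra_simps)+

end

instantiation c0 :: real_normed_vector
begin

lift_definition norm_c0 :: "c0 \<Rightarrow> real" is "\<lambda>x. SUP n. \<bar>x n\<bar>" .

definition dist_c0 :: "c0 \<Rightarrow> c0 \<Rightarrow> real"
  where "dist_c0 x y = norm (x - y)"

definition sgn_c0 :: "c0 \<Rightarrow> c0"
  where "sgn_c0 x = x /\<^sub>R norm x"

definition uniformity_c0 :: "(c0 \<times> c0) filter"
  where "uniformity_c0 = (INF e\<in>{0 <..}. principal {(x, y). dist x y < e})"

definition open_c0 :: "c0 set \<Rightarrow> bool"
  where "open_c0 U \<longleftrightarrow> (\<forall>x\<in>U. eventually (\<lambda>(x', y). x' = x \<longrightarrow> y \<in> U) uniformity)"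

instance
proof
  have bdd: "bdd_above (range (\<lambda>n. \<bar>x n\<bar>))" if "x \<longlonglongrightarrow> 0" for x :: "nat \<Rightarrow> real"
  proof -
    have "Bseq x"
      using that by (rule convergentI[THEN convergent_imp_Bseq])
    then show ?thesis
      unfolding Bseq_def by (auto intro: bdd_aboveI2)
  qed
  have le: "\<bar>x n\<bar> \<le> (SUP n. \<bar>x n\<bar>)" if "x \<longlonglongrightarrow> 0" for x :: "nat \<Rightarrow> real" and n
    using bdd[OF that] by (rule cSUP_upper[rotated]) simp
  show "norm x = 0 \<longleftrightarrow> x = 0" for x :: c0
  proof transfer
    fix x :: "nat \<Rightarrow> real" assume x: "x \<longlonglongrightarrow> 0"
    show "(SUP n. \<bar>x n\<bar>) = 0 \<longleftrightarrow> x = (\<lambda>_. 0)"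
    proof
      assume "(SUP n. \<bar>x n\<bar>) = 0"
      then have "\<bar>x n\<bar> \<le> 0" for n
        using le[OF x, of n] by simp
      then show "x = (\<lambda>_. 0)"
        by auto
    qed simp
  qed
  show "norm (x + y) \<le> norm x + norm y" for x y :: c0
  proof transfer
    fix x y :: "nat \<Rightarrow> real" assume x: "x \<longlonglongrightarrow> 0" and y: "y \<longlonglongrightarrow> 0"
    have "\<bar>x n + y n\<bar> \<le> (SUP n. \<bar>x n\<bar>) + (SUP n. \<bar>y n\<bar>)" for n
      using le[OF x, of n] le[OF y, of n] by linarith
    then show "(SUP n. \<bar>x n + y n\<bar>) \<le> (SUP n. \<bar>x n\<bar>) + (SUP n. \<bar>y n\<bar>)"
      by (intro cSUP_least) auto
  qed
  show "norm (r *\<^sub>R x) = \<bar>r\<bar> * norm x" for r :: real and x :: c0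
  proof transfer
    fix r :: real and x :: "nat \<Rightarrow> real" assume x: "x \<longlonglongrightarrow> 0"
    have upper: "(SUP n. \<bar>s * y n\<bar>) \<le> \<bar>s\<bar> * (SUP n. \<bar>y n\<bar>)"
      if "y \<longlonglongrightarrow> 0" for s :: real and y :: "nat \<Rightarrow> real"
      using le[OF that] by (intro cSUP_least) (auto simp: abs_mult intro: mult_left_mono)
    show "(SUP n. \<bar>r * x n\<bar>) = \<bar>r\<bar> * (SUP n. \<bar>x n\<bar>)"
    proof (cases "r = 0")
      case False
      have rx: "(\<lambda>n. r * x n) \<longlonglongrightarrow> 0"
        using x by (rule tendsto_mult_right_zero)
      have "(SUP n. \<bar>x n\<bar>) \<le> \<bar>inverse r\<bar> * (SUP n. \<bar>r * x n\<bar>)"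
        using upper[OF rx, of "inverse r"] False by (simp add: mult.assoc[symmetric])
      then have "\<bar>r\<bar> * (SUP n. \<bar>x n\<bar>) \<le> \<bar>r\<bar> * (\<bar>inverse r\<bar> * (SUP n. \<bar>r * x n\<bar>))"
        by (rule mult_left_mono) simp
      also have "\<dots> = (SUP n. \<bar>r * x n\<bar>)"
        using False by (simp add: abs_inverse)
      finally show ?thesis
        using upper[OF x, of r] by linarith
    qed simp
  qed
qed (simp_all add: dist_c0_def sgn_c0_def uniformity_c0_def open_c0_def)

end

definition isomorphic_embedding :: "('a::real_normed_vector \<Rightarrow> 'b::real_normed_vector) \<Rightarrow> bool"
  where "isomorphic_embedding T \<longleftrightarrow> linear T \<and> (\<exists>S. homeomorphism UNIV (range T) T S)"

(* Used with K > 0 and 0 < \<alpha> \<le> 1, so 0 powr \<alpha> = 0 agrees with the usual convention. *)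
definition holder_on ::
    "real \<Rightarrow> real \<Rightarrow> 'a::metric_space set \<Rightarrow> ('a \<Rightarrow> 'b::metric_space) \<Rightarrow> bool"
  where "holder_on K \<alpha> M f \<longleftrightarrow>
    (\<forall>x\<in>M. \<forall>y\<in>M. dist (f x) (f y) \<le> K * dist x y powr \<alpha>)"

(* The set B_C(X,Y), intended for C >= 1. *)
definition holder_ext_exponents ::
    "real \<Rightarrow> 'a::metric_space set \<Rightarrow> 'b::metric_space set \<Rightarrow> real set"
  where "holder_ext_exponents C X Y =
    {\<alpha> \<in> {0<..1}. \<forall>K>0. \<forall>M\<subseteq>X. \<forall>f \<in> M \<rightarrow> Y. holder_on K \<alpha> M f \<longrightarrow>
      (\<exists>g \<in> X \<rightarrow> Y. (\<forall>x\<in>M. g x = f x) \<and> holder_on (C * K) \<alpha> X g)}"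

(* The set usually written as A with a tilde. *)
definition almost_isometric_ext_exponents ::
    "'a::metric_space set \<Rightarrow> 'b::metric_space set \<Rightarrow> real set"
  where "almost_isometric_ext_exponents X Y = (\<Inter>C\<in>{1<..}. holder_ext_exponents C X Y)"

end

theory Submission
  imports Defs
begin

text \<open>
  By the Elton--Odell theorem the unit ball of \<open>X\<close> contains a sequence \<open>(x\<^sub>n)\<close> with mutual distances at
  least \<open>b > 1\<close>. By James' distortion argument \<open>Y\<close> contains an almost isometric copy \<open>(u\<^sub>i)\<close> of the unit
  vector basis of \<open>c\<^sub>0\<close>. For every choice of signs \<open>s\<close>, mapping \<open>x\<^sub>n\<close> to \<open>\<Sum>i\<le>n. s\<^sub>i u\<^sub>i\<close> is Hoelder with a
  constant of about \<open>b powr -\<alpha>\<close>, and the value at 0 of an almost isometric extension lies within about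
  \<open>b powr -\<alpha> < 1\<close> of all these sums. Two different choices of signs yield sums at distance
  about 2, so the values at 0 form an uncountable uniformly separated set, contradicting separability.

  For the Elton--Odell theorem, assume that for no \<open>b > 1\<close> the ball contains an infinite \<open>b\<close>-separated
  sequence. Then there are unit vectors \<open>z\<^sub>i\<close> all of whose alternating sums \<open>z\<^sub>0 - z\<^sub>1 + z\<^sub>2 - \<dots>\<close> remain close to
  the unit sphere, each new vector being annihilated by functionals norming the earlier ones. Flipping the
  last sign in the sums of odd length produces a sequence which is almost in the ball and
  2-separated.
\<close>

section \<open>Norming functionals and subspaces of finite codimension\<close>

definition dominated_sublinear :: "('a::real_normed_vector \<Rightarrow> real) \<Rightarrow> bool"
  where "dominated_sublinear p \<longleftrightarrow> (\<forall>x y. p (x + y) \<le> p x + p y) \<and> (\<forall>c x. 0 \<le> c \<longrightarrow> p (c *\<^sub>R x) = c * p x)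
    \<and> (\<forall>x. p x \<le> norm x)"

lemma sublinear_add: "dominated_sublinear p \<Longrightarrow> p (x + y) \<le> p x + p y"
  and sublinear_scale: "dominated_sublinear p \<Longrightarrow> 0 \<le> c \<Longrightarrow> p (c *\<^sub>R x) = c * p x"
  and sublinear_le_norm: "dominated_sublinear p \<Longrightarrow> p x \<le> norm x"
  by (auto simp: dominated_sublinear_def)

lemma sublinear_ge_neg_norm:
  assumes "dominated_sublinear p"
  shows "- norm x \<le> p x"
proof -
  have "0 = p 0"
    using sublinear_scale[OF assms, of 0 0] by simp
  also have "\<dots> \<le> p x + p (- x)"
    using sublinear_add[OF assms, of x "- x"] by simp
  finally show ?thesis
    using sublinear_le_norm[OF assms, of "- x"] by simp
qed

text \<open>The infimum of \<open>p (x + t *\<^sub>R y) - t * p y\<close> over t >= 0 lowers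
  \<open>p\<close> as far as possible in direction \<open>y\<close>: t = 0 gives
  \<open>q \<le> p\<close>, t = 1 the last bound. For a minimal \<open>p\<close> this forces
  additivity; for the norm it prepares a functional norming \<open>y\<close>.\<close>

lemma sublinear_lower:
  assumes p: "dominated_sublinear p"
  obtains q where "dominated_sublinear q" "q \<le> p" "\<And>x. q x \<le> p (x + y) - p y"
proof -
  define h where "h x t = p (x + t *\<^sub>R y) - t * p y" for x t
  define q where "q x = (INF t\<in>{0..}. h x t)" for x
  have lb: "- norm x \<le> h x t" if "0 \<le> t" for x t
  proof -
    have "t * p y = p ((x + t *\<^sub>R y) + (- x))"
      using sublinear_scale[OF p that] by simp
    also have "\<dots> \<le> p (x + t *\<^sub>R y) + p (- x)"
      by (rule sublinear_add[OF p])
    finally show ?thesis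
      using sublinear_le_norm[OF p, of "- x"] by (simp add: h_def)
  qed
  have bdd: "bdd_below (h x ` {0..})" for x
    using lb by (intro bdd_belowI2[of _ "- norm x"]) auto
  have q_le: "q x \<le> h x t" if "0 \<le> t" for x t
    unfolding q_def using that by (intro cINF_lower bdd) auto
  have q_greatest: "c \<le> q x" if "\<And>t. 0 \<le> t \<Longrightarrow> c \<le> h x t" for c x
    unfolding q_def using that by (intro cINF_greatest) auto
  have q_le_p: "q x \<le> p x" for x
    using q_le[of 0 x] by (simp add: h_def)
  have scale_le: "c * q x \<le> q (c *\<^sub>R x)" if "0 < c" for c x
  proof (rule q_greatest)
    fix t :: real assume "0 \<le> t"
    then have "c * q x \<le> c * h x (t / c)"
      using that by (intro mult_left_mono q_le) auto
    also have "\<dots> = h (c *\<^sub>R x) t"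
      using that sublinear_scale[OF p, of c "x + (t / c) *\<^sub>R y"]
      by (simp add: h_def algebra_simps)
    finally show "c * q x \<le> h (c *\<^sub>R x) t" .
  qed
  have "q (x + z) \<le> q x + q z" for x z
  proof -
    have *: "q (x + z) \<le> h x s + h z t" if "0 \<le> s" "0 \<le> t" for s t
    proof -
      have "q (x + z) \<le> h (x + z) (s + t)"
        using that by (intro q_le) auto
      also have "\<dots> \<le> h x s + h z t"
        using sublinear_add[OF p, of "x + s *\<^sub>R y" "z + t *\<^sub>R y"]
        by (simp add: h_def algebra_simps)
      finally show ?thesis .
    qed
    have "q (x + z) - h x s \<le> q z" if "0 \<le> s" for s
      by (rule q_greatest) (use *[OF that] in \<open>simp add: algebra_simps\<close>)
    then have "q (x + z) - q z \<le> q x"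
      by (intro q_greatest) (simp add: algebra_simps)
    then show ?thesis by simp
  qed
  moreover have "q (c *\<^sub>R x) = c * q x" if "0 \<le> c" for c x
  proof (cases "c = 0")
    case True
    have "0 \<le> q 0"
      by (rule q_greatest) (simp add: h_def sublinear_scale[OF p])
    moreover have "p 0 = 0"
      using sublinear_scale[OF p, of 0 0] by simp
    ultimately show ?thesis
      using True q_le_p[of 0] by simp
  next
    case False
    with that have c: "0 < c" by simp
    have "inverse c * q (c *\<^sub>R x) \<le> q x"
      using scale_le[of "inverse c" "c *\<^sub>R x"] c by simp
    then have "q (c *\<^sub>R x) \<le> c * q x"
      using c by (simp add: field_simps)
    with scale_le[OF c, of x] show ?thesis by simp
  qed
  moreover have "q x \<le> norm x" for x
    using q_le_p sublinear_le_norm[OF p] order_trans by blast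
  ultimately have "dominated_sublinear q"
    by (simp add: dominated_sublinear_def)
  moreover have "q x \<le> p (x + y) - p y" for x
    using q_le[of 1 x] by (simp add: h_def)
  ultimately show thesis
    using q_le_p by (intro that) (auto simp: le_fun_def)
qed

text \<open>The chain condition gives subadditivity: of two members, the smaller one bounds the
  infimum at \<open>x + y\<close> by their values at \<open>x\<close> and \<open>y\<close>. The
  common lower bound \<open>- norm x\<close> keeps the infimum finite.\<close>

lemma sublinear_Inf_chain:
  assumes "C \<noteq> {}" and sub: "\<And>p. p \<in> C \<Longrightarrow> dominated_sublinear p"
    and chain: "\<And>p q. p \<in> C \<Longrightarrow> q \<in> C \<Longrightarrow> p \<le> q \<or> q \<le> p"
  shows "dominated_sublinear (\<lambda>x. INF p\<in>C. p x)"
proof -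
  define q where "q x = (INF p\<in>C. p x)" for x
  have bdd: "bdd_below ((\<lambda>p. p x) ` C)" for x
    using sublinear_ge_neg_norm[OF sub] by (intro bdd_belowI2[of _ "- norm x"]) auto
  have q_le: "q x \<le> p x" if "p \<in> C" for p x
    unfolding q_def using that by (intro cINF_lower bdd)
  have q_greatest: "c \<le> q x" if "\<And>p. p \<in> C \<Longrightarrow> c \<le> p x" for c x
    unfolding q_def using that \<open>C \<noteq> {}\<close> by (intro cINF_greatest) auto
  have "q (x + y) \<le> q x + q y" for x y
  proof -
    have *: "q (x + y) \<le> p x + p' y" if "p \<in> C" "p' \<in> C" for p p'
    proof -
      have "\<exists>r\<in>C. r \<le> p \<and> r \<le> p'"
        using chain[OF that] that by blast
      then obtain r where "r \<in> C" "r \<le> p" "r \<le> p'"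
        by blast
      then have "q (x + y) \<le> r x + r y"
        using q_le[of r "x + y"] sublinear_add[OF sub, of r x y] by linarith
      also have "\<dots> \<le> p x + p' y"
        using \<open>r \<le> p\<close> \<open>r \<le> p'\<close> by (intro add_mono) (auto simp: le_fun_def)
      finally show ?thesis .
    qed
    have "q (x + y) - p x \<le> q y" if "p \<in> C" for p
      by (rule q_greatest) (use *[OF that] in \<open>simp add: algebra_simps\<close>)
    then have "q (x + y) - q y \<le> q x"
      by (intro q_greatest) (simp add: algebra_simps)
    then show ?thesis by simp
  qed
  moreover have "q (c *\<^sub>R x) = c * q x" if "0 \<le> c" for c x
  proof (cases "c = 0")
    case True
    have "p 0 = 0" if "p \<in> C" for p
      using sublinear_scale[OF sub[OF that], of 0 0] by simp
    then have "q 0 = (INF p\<in>C. 0)"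
      unfolding q_def by (intro INF_cong) auto
    then show ?thesis
      using True \<open>C \<noteq> {}\<close> by simp
  next
    case False
    with that have c: "0 < c" by simp
    show ?thesis
    proof (rule antisym)
      have "q (c *\<^sub>R x) / c \<le> q x"
      proof (rule q_greatest)
        fix p assume "p \<in> C"
        then show "q (c *\<^sub>R x) / c \<le> p x"
          using q_le[of p "c *\<^sub>R x"] sublinear_scale[OF sub that, of p x] c
          by (simp add: field_simps)
      qed
      then show "q (c *\<^sub>R x) \<le> c * q x"
        using c by (simp add: field_simps)
      show "c * q x \<le> q (c *\<^sub>R x)"
      proof (rule q_greatest)
        fix p assume "p \<in> C"
        then show "c * q x \<le> p (c *\<^sub>R x)"
          using q_le[of p x] sublinear_scale[OF sub that, of p x] c by simp
      qed
    qed
  qed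
  moreover have "q x \<le> norm x" for x
  proof -
    obtain p where "p \<in> C" using \<open>C \<noteq> {}\<close> by blast
    then show ?thesis
      using q_le[of p x] sublinear_le_norm[OF sub, of p x] by linarith
  qed
  ultimately have "dominated_sublinear q"
    by (simp add: dominated_sublinear_def)
  then show ?thesis
    by (simp add: q_def[abs_def])
qed

lemma sublinear_minimal_below:
  assumes p: "dominated_sublinear p"
  obtains m where "dominated_sublinear m" "m \<le> p" "\<And>q. dominated_sublinear q \<Longrightarrow> q \<le> m \<Longrightarrow> q = m"
proof -
  define A where "A = {q. dominated_sublinear q \<and> q \<le> p}"
  have "\<exists>m\<in>A. \<forall>q\<in>A. m \<ge> q \<longrightarrow> q = m"
  proof (rule predicate_Zorn)
    show "partial_order_on A (relation_of (\<ge>) A)"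
      by (rule partial_order_on_relation_ofI) auto
  next
    fix C assume C: "C \<in> Chains (relation_of (\<ge>) A)"
    then have CA: "C \<subseteq> A" and chain: "\<And>q r. q \<in> C \<Longrightarrow> r \<in> C \<Longrightarrow> q \<le> r \<or> r \<le> q"
      by (auto simp: Chains_def relation_of_def)
    show "\<exists>l\<in>A. \<forall>q\<in>C. q \<ge> l"
    proof (cases "C = {}")
      case True
      then show ?thesis using p by (auto simp: A_def)
    next
      case False
      define l where "l x = (INF q\<in>C. q x)" for x
      have sub: "dominated_sublinear q" if "q \<in> C" for q
        using that CA by (auto simp: A_def)
      have "dominated_sublinear l"
        unfolding l_def[abs_def] using False sub chain by (rule sublinear_Inf_chain)
      moreover have l: "l \<le> q" if "q \<in> C" for q
        unfolding l_def le_fun_def using that sublinear_ge_neg_norm[OF sub]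
        by (auto intro!: cINF_lower bdd_belowI2[where m="- norm _"])
      moreover have "l \<le> p"
        using False l CA by (fastforce simp: A_def)
      ultimately show ?thesis
        by (auto simp: A_def)
    qed
  qed
  then obtain m where m: "dominated_sublinear m" "m \<le> p" and min: "\<And>q. q \<in> A \<Longrightarrow> q \<le> m \<Longrightarrow> q = m"
    by (auto simp: A_def)
  have "q = m" if "dominated_sublinear q" "q \<le> m" for q
    using min[of q] that m by (auto simp: A_def)
  with m show thesis
    by (intro that)
qed

text \<open>Lowering \<open>m\<close> in direction \<open>y\<close> returns \<open>m\<close> by
  minimality, so \<open>m x \<le> m (x + y) - m y\<close>, the converse of subadditivity.\<close>

lemma minimal_sublinear_imp_bounded_linear:
  assumes m: "dominated_sublinear m" and min: "\<And>q. dominated_sublinear q \<Longrightarrow> q \<le> m \<Longrightarrow> q = m"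
  shows "bounded_linear m"
proof -
  have add: "m (x + y) = m x + m y" for x y
  proof -
    obtain q where "dominated_sublinear q" "q \<le> m" and q: "\<And>x. q x \<le> m (x + y) - m y"
      using sublinear_lower[OF m] by blast
    then have "q = m" by (intro min)
    with q[of x] sublinear_add[OF m, of x y] show ?thesis by simp
  qed
  have "m 0 = 0"
    using sublinear_scale[OF m, of 0 0] by simp
  then have neg: "m (- x) = - m x" for x
    using add[of x "- x"] by simp
  have scale: "m (c *\<^sub>R x) = c *\<^sub>R m x" for c x
  proof (cases "0 \<le> c")
    case True
    then show ?thesis by (simp add: sublinear_scale[OF m])
  next
    case False
    then have "m ((- c) *\<^sub>R x) = - c * m x"
      by (intro sublinear_scale[OF m]) auto
    then show ?thesis
      using neg[of "c *\<^sub>R x"] by simp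
  qed
  have "norm (m x) \<le> norm x * 1" for x
    using sublinear_le_norm[OF m, of x] sublinear_ge_neg_norm[OF m, of x] by (simp add: abs_le_iff)
  with add scale show ?thesis
    by (intro bounded_linear_intro[where K = 1]) auto
qed

text \<open>The functional \<open>\<phi>\<close> is a linear minorant of \<open>p\<close>, and
  \<open>p (- f) \<le> - norm f\<close>; by linearity this reads
  \<open>norm f \<le> \<phi> f\<close>.\<close>

lemma norming_functional:
  fixes f :: "'a::real_normed_vector"
  obtains \<phi> :: "'a \<Rightarrow> real" where "bounded_linear \<phi>" "\<And>x. \<phi> x \<le> norm x" "\<phi> f = norm f"
proof -
  have "dominated_sublinear (norm :: 'a \<Rightarrow> real)"
    by (auto simp: dominated_sublinear_def norm_triangle_ineq)
  then obtain p where p: "dominated_sublinear p" "\<And>x. p x \<le> norm (x + f) - norm f"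
    using sublinear_lower by blast
  obtain \<phi> where \<phi>: "dominated_sublinear \<phi>" "\<phi> \<le> p" "\<And>q. dominated_sublinear q \<Longrightarrow> q \<le> \<phi> \<Longrightarrow> q = \<phi>"
    using sublinear_minimal_below[OF p(1)] by blast
  then have lin: "bounded_linear \<phi>"
    using minimal_sublinear_imp_bounded_linear by blast
  have "\<phi> (- f) \<le> p (- f)"
    using \<phi>(2) by (simp add: le_fun_def)
  with p(2)[of "- f"] have "norm f \<le> \<phi> f"
    by (simp add: linear_neg[OF bounded_linear.linear[OF lin]])
  with sublinear_le_norm[OF \<phi>(1)] show thesis
    by (intro that[of \<phi>] lin) (auto intro: antisym)
qed

section \<open>Closed subspaces of finite codimension\<close>

definition cofinite_dim :: "'a::real_normed_vector set \<Rightarrow> bool"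
  where "cofinite_dim W \<longleftrightarrow>
    (\<exists>\<Phi>. finite \<Phi> \<and> (\<forall>\<phi>\<in>\<Phi>. bounded_linear \<phi>) \<and> W = {x. \<forall>\<phi>\<in>\<Phi>. \<phi> x = (0::real)})"

lemma cofinite_dim_UNIV: "cofinite_dim UNIV"
  unfolding cofinite_dim_def by (rule exI[of _ "{}"]) simp

lemma cofinite_dim_Int:
  assumes "cofinite_dim V" "cofinite_dim W"
  shows "cofinite_dim (V \<inter> W)"
proof -
  obtain \<Phi> \<Psi> where "finite \<Phi>" "\<forall>\<phi>\<in>\<Phi>. bounded_linear \<phi>" "V = {x. \<forall>\<phi>\<in>\<Phi>. \<phi> x = (0::real)}"
    "finite \<Psi>" "\<forall>\<phi>\<in>\<Psi>. bounded_linear \<phi>" "W = {x. \<forall>\<phi>\<in>\<Psi>. \<phi> x = (0::real)}"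
    using assms unfolding cofinite_dim_def by blast
  then show ?thesis
    unfolding cofinite_dim_def by (intro exI[of _ "\<Phi> \<union> \<Psi>"]) auto
qed

lemma cofinite_dim_INT:
  assumes "finite I" "\<And>i. i \<in> I \<Longrightarrow> cofinite_dim (W i)"
  shows "cofinite_dim (\<Inter>i\<in>I. W i)"
  using assms by (induction I rule: finite_induct) (auto intro: cofinite_dim_UNIV cofinite_dim_Int)

lemma cofinite_dim_subspace:
  assumes "cofinite_dim W"
  shows "subspace W"
proof -
  obtain \<Phi> where \<Phi>: "\<forall>\<phi>\<in>\<Phi>. bounded_linear \<phi>" "W = {x. \<forall>\<phi>\<in>\<Phi>. \<phi> x = (0::real)}"
    using assms unfolding cofinite_dim_def by blast
  then show ?thesis
    unfolding subspace_def
    by (auto simp: linear_0 linear_add linear_cmul bounded_linear.linear)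
qed

text \<open>Each functional costs at most one new vector: either \<open>\<psi>\<close> vanishes on
  the joint kernel of the earlier ones, or some \<open>e\<close> in that kernel has
  \<open>\<psi> e \<noteq> 0\<close> and a multiple of \<open>e\<close> corrects the value of
  \<open>\<psi>\<close>.\<close>

lemma cofinite_dim_complement:
  fixes \<Phi> :: "('a::real_normed_vector \<Rightarrow> real) set"
  assumes "finite \<Phi>" "\<forall>\<phi>\<in>\<Phi>. linear \<phi>"
  shows "\<exists>B. finite B \<and> (\<forall>x. \<exists>b\<in>span B. \<forall>\<phi>\<in>\<Phi>. \<phi> (x - b) = 0)"
  using assms
proof (induction \<Phi> rule: finite_induct)
  case empty
  show ?case by (intro exI[of _ "{}"]) auto
next
  case (insert \<psi> \<Phi>)
  then obtain B where B: "finite B" "\<And>x. \<exists>b\<in>span B. \<forall>\<phi>\<in>\<Phi>. \<phi> (x - b) = 0"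
    by auto
  have \<psi>: "linear \<psi>" using insert.prems by simp
  show ?case
  proof (cases "\<exists>e. (\<forall>\<phi>\<in>\<Phi>. \<phi> e = 0) \<and> \<psi> e \<noteq> 0")
    case False
    then have "\<exists>b\<in>span B. \<forall>\<phi>\<in>insert \<psi> \<Phi>. \<phi> (x - b) = 0" for x
      using B(2)[of x] by blast
    then show ?thesis using B(1) by blast
  next
    case True
    then obtain e where e: "\<And>\<phi>. \<phi> \<in> \<Phi> \<Longrightarrow> \<phi> e = 0" "\<psi> e \<noteq> 0" by blast
    have "\<exists>b\<in>span (insert e B). \<forall>\<phi>\<in>insert \<psi> \<Phi>. \<phi> (x - b) = 0" for x
    proof -
      obtain b where b: "b \<in> span B" "\<And>\<phi>. \<phi> \<in> \<Phi> \<Longrightarrow> \<phi> (x - b) = 0"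
        using B(2) by blast
      define c where "c = \<psi> (x - b) / \<psi> e"
      have "b \<in> span (insert e B)"
        using b(1) span_mono[of B "insert e B"] by blast
      then have "b + c *\<^sub>R e \<in> span (insert e B)"
        by (intro span_add[OF _ span_scale] span_base[of e]) auto
      moreover have "\<phi> (x - (b + c *\<^sub>R e)) = 0" if "\<phi> \<in> insert \<psi> \<Phi>" for \<phi>
      proof -
        have "linear \<phi>"
          using that insert.prems by blast
        then have "\<phi> (x - (b + c *\<^sub>R e)) = \<phi> (x - b) - c * \<phi> e"
          by (simp add: linear_diff linear_add linear_cmul)
        then show ?thesis
          using that b(2)[of \<phi>] e(1)[of \<phi>] e(2) by (auto simp: c_def)
      qed
      ultimately show ?thesis
        by blast
    qed
    then show ?thesis
      using B(1) by (intro exI[of _ "insert e B"]) auto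
  qed
qed

text \<open>Without unit vectors \<open>W\<close> would be 0, and the finite set spanning a
  complement of \<open>W\<close> would span the whole space.\<close>

lemma cofinite_dim_unit_vector:
  assumes inf: "\<not> (\<exists>B :: 'a::real_normed_vector set. finite B \<and> span B = UNIV)"
    and W: "cofinite_dim (W :: 'a set)"
  shows "\<exists>x\<in>W. norm x = 1"
proof (rule ccontr)
  assume no: "\<not> (\<exists>x\<in>W. norm x = 1)"
  have zero: "x = 0" if "x \<in> W" for x
  proof (rule ccontr)
    assume "x \<noteq> 0"
    moreover have "x /\<^sub>R norm x \<in> W"
      using that cofinite_dim_subspace[OF W] by (rule subspace_scale[rotated])
    ultimately show False
      using no by auto
  qed
  obtain \<Phi> where "finite \<Phi>" "\<forall>\<phi>\<in>\<Phi>. bounded_linear \<phi>" and \<Phi>: "W = {x. \<forall>\<phi>\<in>\<Phi>. \<phi> x = (0::real)}"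
    using W unfolding cofinite_dim_def by blast
  then obtain B where B: "finite B" "\<And>x. \<exists>b\<in>span B. \<forall>\<phi>\<in>\<Phi>. \<phi> (x - b) = 0"
    using cofinite_dim_complement[of \<Phi>] by (auto simp: bounded_linear.linear)
  have "x \<in> span B" for x
  proof -
    obtain b where "b \<in> span B" "x - b \<in> W"
      using B(2) \<Phi> by blast
    then show ?thesis using zero[of "x - b"] by simp
  qed
  with inf B(1) show False by blast
qed

text \<open>On the kernel of a functional \<open>\<phi>\<close> norming \<open>f\<close>,
  \<open>norm f = \<phi> (f + z) \<le> norm (f + z)\<close>.\<close>

lemma cofinite_dim_norm_le_add:
  fixes f :: "'a::real_normed_vector"
  shows "\<exists>W. cofinite_dim W \<and> (\<forall>z\<in>W. norm f \<le> norm (f + z))"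
proof -
  obtain \<phi> :: "'a \<Rightarrow> real" where \<phi>: "bounded_linear \<phi>" "\<And>x. \<phi> x \<le> norm x" "\<phi> f = norm f"
    using norming_functional by blast
  have "norm f \<le> norm (f + z)" if "\<phi> z = 0" for z
    using \<phi>(2)[of "f + z"] \<phi>(3) that linear_add[OF bounded_linear.linear[OF \<phi>(1)], of f z] by simp
  then show ?thesis
    unfolding cofinite_dim_def using \<phi>(1)
    by (intro exI[of _ "{x. \<phi> x = 0}"]) (auto intro!: exI[of _ "{\<phi>}"])
qed

section \<open>The Elton--Odell theorem\<close>

text \<open>A strong form of nonemptiness: a further point of \<open>P\<close> can always be found
  in the kernels of finitely many prescribed functionals.\<close>

definition meets_cofinite_dim :: "'a::real_normed_vector set \<Rightarrow> bool"
  where "meets_cofinite_dim P \<longleftrightarrow> (\<forall>W. cofinite_dim W \<longrightarrow> P \<inter> W \<noteq> {})"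

text \<open>A pair \<open>(e, c)\<close> requires distance greater than \<open>c\<close> from \<open>e\<close>, and \<open>t\<close> is a slack common to all pairs.\<close>

definition separated_from :: "('a::real_normed_vector \<times> real) set \<Rightarrow> real \<Rightarrow> 'a set"
  where "separated_from E t = {x. \<forall>(e, c)\<in>E. c - t < norm (e - x)}"

definition asymptotically_near :: "'a::real_normed_vector set \<Rightarrow> real \<Rightarrow> bool"
  where "asymptotically_near P a \<longleftrightarrow>
    (\<forall>u\<in>P. \<exists>W. cofinite_dim W \<and> (\<forall>z\<in>P \<inter> W. norm (u - z) \<le> a))"

lemma asymptotically_near_mono:
  assumes "asymptotically_near P a" "a \<le> b"
  shows "asymptotically_near P b"
  using assms unfolding asymptotically_near_def by (meson order_trans)

lemma separated_from_mono: "E \<subseteq> F \<Longrightarrow> s \<le> t \<Longrightarrow> separated_from F s \<subseteq> separated_from E t"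
  unfolding separated_from_def by fastforce

lemma separated_fromD: "x \<in> separated_from E t \<Longrightarrow> (e, c) \<in> E \<Longrightarrow> c - t < norm (e - x)"
  unfolding separated_from_def by auto

text \<open>As long as the conclusion fails, another point \<open>u\<close> can be adjoined to the constraints while some
  room remains in every subspace of finite codimension. The slack grows at each step but stays
  bounded, so the adjoined points would form an infinite separated sequence.\<close>

lemma asymptotically_near_refinement:
  fixes E :: "('a::real_normed_vector \<times> real) set"
  assumes nosep: "\<not> (\<exists>b (x :: nat \<Rightarrow> 'a). 1 < b \<and> (\<forall>n. norm (x n) \<le> 1) \<and>
      (\<forall>m n. m < n \<longrightarrow> b \<le> norm (x m - x n)))"
    and E: "finite E" "meets_cofinite_dim (sphere 0 1 \<inter> separated_from E t)"
    and a: "1 < a" and \<tau>: "0 < \<tau>"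
  obtains E' t' \<sigma> where "finite E'" "E \<subseteq> E'" "t \<le> t'" "0 < \<sigma>" "t' + \<sigma> \<le> t + \<tau>"
    "meets_cofinite_dim (sphere 0 1 \<inter> separated_from E' t')"
    "asymptotically_near (sphere 0 1 \<inter> separated_from E' (t' + \<sigma>)) a"
proof (rule ccontr)
  assume "\<not> thesis"
  note no = this that
  \<comment> \<open>The bound \<open>\<tau>\<close> keeps the total slack admissible; the bound
    \<open>(a - 1) / 2\<close> leaves separation at least \<open>(1 + a) / 2 > 1\<close>.\<close>
  define s where "s = min \<tau> ((a - 1) / 2)"
  have s: "0 < s" "s \<le> \<tau>" "s \<le> (a - 1) / 2"
    using a \<tau> by (auto simp: s_def min_def)
  define T where "T k = t + s * (1 - 1 / 2 ^ k)" for k :: nat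
  have T_0: "T 0 = t" by (simp add: T_def)
  have T_Suc: "T k < T (Suc k)" for k
    using s by (simp add: T_def field_simps)
  have T_le: "T k \<le> t + s" for k
    using s by (simp add: T_def field_simps)
  have T_ge: "t \<le> T k" for k
    using s by (simp add: T_def field_simps)
  define P where "P k F \<longleftrightarrow> finite F \<and> E \<subseteq> F \<and> meets_cofinite_dim (sphere 0 1 \<inter> separated_from F (T k))"
    for k F
  \<comment> \<open>The radius \<open>a + t\<close> absorbs the initial slack: a distance above
    \<open>a\<close> meets the constraint now, and later slacks reduce the guaranteed distance by at
    most \<open>s\<close>.\<close>
  define Q where "Q k F F' \<longleftrightarrow> (\<exists>u\<in>sphere 0 1 \<inter> separated_from F (T (Suc k)). F' = insert (u, a + t) F)"
    for k and F F' :: "('a \<times> real) set"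
  have "\<exists>F. \<forall>k. P k (F k) \<and> Q k (F k) (F (Suc k))"
  proof (rule dependent_nat_choice)
    show "\<exists>F. P 0 F"
      using E T_0 by (auto simp: P_def)
  next
    fix F k assume P: "P k F"
    let ?S = "sphere 0 1 \<inter> separated_from F (T (Suc k))"
    \<comment> \<open>Otherwise \<open>F\<close>, \<open>T k\<close> and
      \<open>\<sigma> = T (Suc k) - T k\<close> would already satisfy the conclusion.\<close>
    have "\<not> asymptotically_near ?S a"
      using no(1) no(2)[of F "T k" "T (Suc k) - T k"] P T_ge[of k] T_Suc[of k] T_le[of "Suc k"] s
      by (auto simp: P_def)
    then obtain u where u: "u \<in> ?S"
      and far: "\<And>W. cofinite_dim W \<Longrightarrow> \<exists>z\<in>?S \<inter> W. a < norm (u - z)"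
      unfolding asymptotically_near_def by (auto simp: not_le)
    have "meets_cofinite_dim (sphere 0 1 \<inter> separated_from (insert (u, a + t) F) (T (Suc k)))"
      unfolding meets_cofinite_dim_def
    proof (intro allI impI)
      fix W :: "'a set" assume "cofinite_dim W"
      then obtain z where z: "z \<in> ?S \<inter> W" "a < norm (u - z)"
        using far by blast
      then have "z \<in> separated_from (insert (u, a + t) F) (T (Suc k))"
        using T_ge[of "Suc k"] by (auto simp: separated_from_def)
      with z show "sphere 0 1 \<inter> separated_from (insert (u, a + t) F) (T (Suc k)) \<inter> W \<noteq> {}"
        by auto
    qed
    with P u show "\<exists>F'. P (Suc k) F' \<and> Q k F F'"
      by (intro exI[of _ "insert (u, a + t) F"]) (auto simp: P_def Q_def)
  qed
  then obtain F where "\<And>k. Q k (F k) (F (Suc k))"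
    by blast
  then obtain u where u: "\<And>k. u k \<in> sphere 0 1 \<inter> separated_from (F k) (T (Suc k))"
    and F: "\<And>k. F (Suc k) = insert (u k, a + t) (F k)"
    unfolding Q_def by metis
  have "mono F"
    by (rule incseq_SucI) (auto simp: F)
  have sep: "(1 + a) / 2 \<le> norm (u j - u k)" if "j < k" for j k
  proof -
    have "(u j, a + t) \<in> F k"
      using monoD[OF \<open>mono F\<close>, of "Suc j" k] that by (auto simp: F)
    then have "a + t - T (Suc k) < norm (u j - u k)"
      using u[of k] separated_fromD by blast
    with T_le[of "Suc k"] s show ?thesis by (simp add: field_simps)
  qed
  have "\<forall>n. norm (u n) \<le> 1"
    using u by auto
  with nosep sep a show False
    by (auto dest!: spec[of _ "(1 + a) / 2"] spec[of _ u])
qed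

text \<open>The tolerances are set so that normalizing moves a point by at most
  \<open>\<sigma> / 4\<close> and ends within slack \<open>t + \<sigma>\<close>, while unit vectors
  with slack \<open>t + \<sigma> / 2\<close> belong to the class.\<close>

definition near_class :: "('a::real_normed_vector \<times> real) set \<Rightarrow> real \<Rightarrow> real \<Rightarrow> 'a set"
  where "near_class E t \<sigma> = {x. \<bar>norm x - 1\<bar> \<le> \<sigma> / 4} \<inter> separated_from E (t + \<sigma> / 2)"

lemma near_class_normalize:
  assumes "x \<in> near_class E t \<sigma>" "0 < \<sigma>" "\<sigma> \<le> 1"
  shows "x /\<^sub>R norm x \<in> sphere 0 1 \<inter> separated_from E (t + \<sigma>)"
    and "norm (x - x /\<^sub>R norm x) \<le> \<sigma> / 4"
proof -
  have n: "\<bar>norm x - 1\<bar> \<le> \<sigma> / 4"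
    using assms by (simp add: near_class_def)
  then have "x \<noteq> 0" using assms by auto
  have "x - x /\<^sub>R norm x = (1 - inverse (norm x)) *\<^sub>R x"
    by (simp add: algebra_simps)
  then have "norm (x - x /\<^sub>R norm x) = \<bar>(1 - inverse (norm x)) * norm x\<bar>"
    by (simp add: abs_mult)
  also have "(1 - inverse (norm x)) * norm x = norm x - 1"
    using \<open>x \<noteq> 0\<close> by (simp add: field_simps)
  finally show *: "norm (x - x /\<^sub>R norm x) \<le> \<sigma> / 4"
    using n by simp
  have "c - (t + \<sigma>) < norm (e - x /\<^sub>R norm x)" if "(e, c) \<in> E" for e c
  proof -
    have "c - (t + \<sigma> / 2) < norm (e - x)"
      using assms that by (auto simp: near_class_def dest: separated_fromD)
    also have "\<dots> \<le> norm (e - x /\<^sub>R norm x) + norm (x - x /\<^sub>R norm x)"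
      using norm_triangle_ineq4[of "e - x /\<^sub>R norm x" "x - x /\<^sub>R norm x"] by simp
    finally show ?thesis using * assms by simp
  qed
  then show "x /\<^sub>R norm x \<in> sphere 0 1 \<inter> separated_from E (t + \<sigma>)"
    using \<open>x \<noteq> 0\<close> by (auto simp: separated_from_def)
qed

text \<open>The bound for the normalized points is used; each of the two normalizations costs
  \<open>\<sigma> / 4\<close>, and a subspace is preserved by scaling.\<close>

lemma near_class_asymptotically_near:
  assumes near: "asymptotically_near (sphere 0 1 \<inter> separated_from E (t + \<sigma>)) a"
    and \<sigma>: "0 < \<sigma>" "\<sigma> \<le> 1"
  shows "asymptotically_near (near_class E t \<sigma>) (a + \<sigma> / 2)"
  unfolding asymptotically_near_def
proof
  fix u assume u: "u \<in> near_class E t \<sigma>"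
  let ?n = "\<lambda>x :: 'a. x /\<^sub>R norm x"
  obtain W where W: "cofinite_dim W"
    "\<And>z. z \<in> sphere 0 1 \<inter> separated_from E (t + \<sigma>) \<Longrightarrow> z \<in> W \<Longrightarrow> norm (?n u - z) \<le> a"
    using near near_class_normalize(1)[OF u \<sigma>] unfolding asymptotically_near_def by blast
  have "norm (u - z) \<le> a + \<sigma> / 2" if z: "z \<in> near_class E t \<sigma>" "z \<in> W" for z
  proof -
    have "?n z \<in> W"
      using z(2) cofinite_dim_subspace[OF W(1)] by (rule subspace_scale[rotated])
    then have "norm (?n u - ?n z) \<le> a"
      using near_class_normalize(1)[OF z(1) \<sigma>] W(2) by blast
    moreover have "norm (u - z) \<le> norm (u - ?n u) + norm (?n u - ?n z) + norm (z - ?n z)"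
      using norm_triangle_ineq4[of "(u - ?n u) + (?n u - ?n z)" "z - ?n z"]
        norm_triangle_ineq[of "u - ?n u" "?n u - ?n z"] by simp
    ultimately show ?thesis
      using near_class_normalize(2)[OF u \<sigma>] near_class_normalize(2)[OF z(1) \<sigma>] by simp
  qed
  with W(1) show "\<exists>W. cofinite_dim W \<and> (\<forall>z\<in>near_class E t \<sigma> \<inter> W. norm (u - z) \<le> a + \<sigma> / 2)"
    by blast
qed

lemma sphere_subset_near_class:
  assumes "0 < \<sigma>"
  shows "sphere 0 1 \<inter> separated_from E (t + \<sigma> / 2) \<subseteq> near_class E t \<sigma>"
  using assms by (auto simp: near_class_def)

text \<open>The class indexed by \<open>E'\<close> is the finer one. Its differences fall into the coarser class, not back into
  itself; the tolerances therefore decrease along the sequence built in \<open>elton_odell\<close>, and sums of any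
  length remain in the coarsest class.\<close>

lemma near_class_diff:
  assumes \<sigma>: "0 < \<sigma>" "\<sigma> \<le> 1" "0 < \<sigma>'" and sub: "E \<subseteq> E'" and t: "t \<le> t'" "t' + \<sigma>' \<le> t + \<sigma> / 4"
    and near: "asymptotically_near (sphere 0 1 \<inter> separated_from E' (t' + \<sigma>')) (1 + \<sigma> / 8)"
    and E: "finite E" and u: "u \<in> sphere 0 1 \<inter> separated_from E' t'"
  shows "\<exists>W. cofinite_dim W \<and> (\<forall>z\<in>near_class E' t' \<sigma>' \<inter> W. u - z \<in> near_class E t \<sigma>)"
proof -
  have "u \<in> near_class E' t' \<sigma>'"
    using u \<sigma> sphere_subset_near_class[of \<sigma>' E' t'] separated_from_mono[of E' E' t' "t' + \<sigma>' / 2"] by auto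
  moreover have "asymptotically_near (near_class E' t' \<sigma>') (1 + \<sigma> / 8 + \<sigma>' / 2)"
    using near \<sigma> t by (intro near_class_asymptotically_near) auto
  ultimately obtain W where W: "cofinite_dim W"
    "\<And>z. z \<in> near_class E' t' \<sigma>' \<Longrightarrow> z \<in> W \<Longrightarrow> norm (u - z) \<le> 1 + \<sigma> / 8 + \<sigma>' / 2"
    unfolding asymptotically_near_def by blast
  obtain N where N: "\<And>f :: 'a. cofinite_dim (N f)" "\<And>f z. z \<in> N f \<Longrightarrow> norm f \<le> norm (f + z)"
    using cofinite_dim_norm_le_add by metis
  \<comment> \<open>\<open>W\<close> bounds \<open>norm (u - z)\<close> from above,
    \<open>N u\<close> from below, and the \<open>N (e - u)\<close> preserve the distances from
    \<open>u\<close> to the finitely many points in \<open>E\<close>.\<close>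
  define V where "V = W \<inter> N u \<inter> (\<Inter>(e, c)\<in>E. N (e - u))"
  have "cofinite_dim V"
    unfolding V_def using W(1) N(1) E by (intro cofinite_dim_Int cofinite_dim_INT) auto
  moreover have "u - z \<in> near_class E t \<sigma>" if z: "z \<in> near_class E' t' \<sigma>'" "z \<in> V" for z
  proof -
    have "- z \<in> N u"
      using z(2) cofinite_dim_subspace[OF N(1)] subspace_neg by (auto simp: V_def)
    then have "1 \<le> norm (u - z)"
      using N(2)[of "- z" u] u by simp
    \<comment> \<open>The hypotheses on \<open>t'\<close> give
      \<open>\<sigma>' \<le> \<sigma> / 4\<close>, hence
      \<open>\<sigma>' / 2 \<le> \<sigma> / 8\<close>.\<close>
    moreover have "norm (u - z) \<le> 1 + \<sigma> / 4"
      using W(2)[OF z(1)] z(2) t by (auto simp: V_def)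
    moreover have "c - (t + \<sigma> / 2) < norm (e - (u - z))" if "(e, c) \<in> E" for e c
    proof -
      have "c - (t + \<sigma> / 2) < norm (e - u)"
        using separated_fromD[of u E' t' e c] u that sub t \<sigma> by auto
      also have "\<dots> \<le> norm (e - u + z)"
        using that z(2) by (intro N(2)) (auto simp: V_def)
      finally show ?thesis by (simp add: algebra_simps)
    qed
    ultimately show ?thesis
      using \<sigma> by (auto simp: near_class_def separated_from_def)
  qed
  ultimately show ?thesis by blast
qed

text \<open>There are two successive dependent choices: first the triples
  \<open>(E n, t n, \<sigma> n)\<close>, which fix the classes \<open>C n\<close>, then the vectors
  \<open>z n\<close> with their alternating sums and decreasing subspaces that confine all later
  vectors.\<close>

lemma elton_odell:
  assumes inf: "\<not> (\<exists>B :: 'a::real_normed_vector set. finite B \<and> span B = UNIV)"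
  shows "\<exists>b (x :: nat \<Rightarrow> 'a). 1 < b \<and> (\<forall>n. norm (x n) \<le> 1) \<and>
    (\<forall>m n. m < n \<longrightarrow> b \<le> norm (x m - x n))"
proof (rule ccontr)
  assume nosep: "\<not> ?thesis"
  \<comment> \<open>The constants 9/8 and 1/4 make \<open>9 / 8 + \<sigma> / 2 \<le> 5 / 4\<close>,
    which is well below the separation 2 reached at the end.\<close>
  define P where "P (n::nat) = (\<lambda>(E :: ('a \<times> real) set, t, \<sigma>). finite E \<and> 0 < \<sigma> \<and> \<sigma> \<le> 1 / 4 \<and>
      meets_cofinite_dim (sphere 0 1 \<inter> separated_from E t) \<and>
      asymptotically_near (sphere 0 1 \<inter> separated_from E (t + \<sigma>)) (9 / 8))" for n
  define Q where "Q (n::nat) = (\<lambda>(E :: ('a \<times> real) set, t, \<sigma>) (E', t', \<sigma>'). E \<subseteq> E' \<and> t \<le> t' \<and>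
      t' + \<sigma>' \<le> t + \<sigma> / 4 \<and> asymptotically_near (sphere 0 1 \<inter> separated_from E' (t' + \<sigma>')) (1 + \<sigma> / 8))"
    for n
  have "\<exists>f. \<forall>n. P n (f n) \<and> Q n (f n) (f (Suc n))"
  proof (rule dependent_nat_choice)
    have "meets_cofinite_dim (sphere 0 1 \<inter> separated_from ({} :: ('a \<times> real) set) 0)"
      unfolding meets_cofinite_dim_def separated_from_def
      using cofinite_dim_unit_vector[OF inf] by fastforce
    from asymptotically_near_refinement[OF nosep finite.emptyI this, of "9 / 8" "1 / 4"]
    obtain E' :: "('a \<times> real) set" and t' \<sigma> where "finite E'" "0 \<le> t'" "0 < \<sigma>" "t' + \<sigma> \<le> 0 + 1 / 4"
      "meets_cofinite_dim (sphere 0 1 \<inter> separated_from E' t')"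
      "asymptotically_near (sphere 0 1 \<inter> separated_from E' (t' + \<sigma>)) (9 / 8)"
      by auto
    then have "P 0 (E', t', \<sigma>)"
      by (simp add: P_def)
    then show "\<exists>s. P 0 s" by blast
  next
    fix s n assume P: "P n s"
    obtain E t \<sigma> where s: "s = (E, t, \<sigma>)" by (cases s)
    have "finite E" "meets_cofinite_dim (sphere 0 1 \<inter> separated_from E t)" "1 < 1 + \<sigma> / 8" "0 < \<sigma> / 4"
      using P by (auto simp: P_def s)
    from asymptotically_near_refinement[OF nosep this] obtain E' t' \<sigma>' where 1: "finite E'" "E \<subseteq> E'" "t \<le> t'"
      "0 < \<sigma>'" "t' + \<sigma>' \<le> t + \<sigma> / 4"
      "meets_cofinite_dim (sphere 0 1 \<inter> separated_from E' t')"
      "asymptotically_near (sphere 0 1 \<inter> separated_from E' (t' + \<sigma>')) (1 + \<sigma> / 8)"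
      by blast
    moreover have "asymptotically_near (sphere 0 1 \<inter> separated_from E' (t' + \<sigma>')) (9 / 8)"
      using P by (intro asymptotically_near_mono[OF 1(7)]) (simp add: P_def s)
    ultimately show "\<exists>s'. P (Suc n) s' \<and> Q n s s'"
      using P by (intro exI[of _ "(E', t', \<sigma>')"]) (auto simp: P_def Q_def s)
  qed
  then obtain f where f: "\<And>n. P n (f n)" "\<And>n. Q n (f n) (f (Suc n))"
    by blast
  define E where "E n = fst (f n)" for n
  define t where "t n = fst (snd (f n))" for n
  define \<sigma> where "\<sigma> n = snd (snd (f n))" for n
  have f_eq: "f n = (E n, t n, \<sigma> n)" for n
    by (simp add: E_def t_def \<sigma>_def)
  have E: "finite (E n)" and \<sigma>: "0 < \<sigma> n" "\<sigma> n \<le> 1 / 4"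
    and pool: "meets_cofinite_dim (sphere 0 1 \<inter> separated_from (E n) (t n))"
    and near: "asymptotically_near (sphere 0 1 \<inter> separated_from (E n) (t n + \<sigma> n)) (9 / 8)" for n
    using f(1)[of n] by (auto simp: P_def f_eq)
  have E_Suc: "E n \<subseteq> E (Suc n)" and t_Suc: "t n \<le> t (Suc n)" "t (Suc n) + \<sigma> (Suc n) \<le> t n + \<sigma> n / 4"
    and near_Suc: "asymptotically_near (sphere 0 1 \<inter> separated_from (E (Suc n)) (t (Suc n) + \<sigma> (Suc n))) (1 + \<sigma> n / 8)" for n
    using f(2)[of n] by (auto simp: Q_def f_eq)
  define C where "C n = near_class (E n) (t n) (\<sigma> n)" for n
  \<comment> \<open>The index is shifted: new vectors obey the constraints of level
    \<open>Suc n\<close>, as subtracting an element of \<open>C (Suc n)\<close> from them must lead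
    into \<open>C n\<close>.\<close>
  define A where "A n = sphere 0 1 \<inter> separated_from (E (Suc n)) (t (Suc n))" for n
  have E_0: "E 0 \<subseteq> E n" for n
    by (rule lift_Suc_mono_le[of E 0 n]) (use E_Suc in auto)
  have t_0: "t (Suc n) + \<sigma> (Suc n) \<le> t 0 + \<sigma> 0 / 4" for n
  proof (induction n)
    case (Suc n)
    then show ?case using t_Suc(2)[of "Suc n"] \<sigma>(1)[of "Suc n"] by linarith
  qed (use t_Suc in auto)
  have A_C: "A n \<subseteq> C n" for n
  proof -
    have "A n \<subseteq> sphere 0 1 \<inter> separated_from (E n) (t n + \<sigma> n / 2)"
      unfolding A_def using separated_from_mono[OF E_Suc, of "t (Suc n)" "t n + \<sigma> n / 2" n] t_Suc(2)[of n]
        \<sigma>(1)[of n] \<sigma>(1)[of "Suc n"] by fastforce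
    then show ?thesis
      unfolding C_def using sphere_subset_near_class[OF \<sigma>(1)] by blast
  qed
  have A_C0: "A n \<subseteq> C 0" for n
  proof -
    have "A n \<subseteq> sphere 0 1 \<inter> separated_from (E 0) (t 0 + \<sigma> 0 / 2)"
      unfolding A_def using separated_from_mono[OF E_0, of "t (Suc n)" "t 0 + \<sigma> 0 / 2" "Suc n"] t_0[of n]
        \<sigma>(1)[of 0] \<sigma>(1)[of "Suc n"] by fastforce
    then show ?thesis
      unfolding C_def using sphere_subset_near_class[OF \<sigma>(1)] by blast
  qed
  \<comment> \<open>The implication lets a subspace exist for every \<open>u\<close>, with
    \<open>UNIV\<close> as default outside \<open>A n\<close>.\<close>
  have ex_G: "\<exists>W. cofinite_dim W \<and> (u \<in> A n \<longrightarrow> (\<forall>z\<in>C (Suc n) \<inter> W. u - z \<in> C n))" for n u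
  proof (cases "u \<in> A n")
    case True
    then show ?thesis
      unfolding A_def C_def using \<sigma>[of n] \<sigma>[of "Suc n"]
      using near_class_diff[OF _ _ _ E_Suc t_Suc near_Suc E] by fastforce
  qed (auto intro: cofinite_dim_UNIV)
  define G where "G n u = (SOME W. cofinite_dim W \<and> (u \<in> A n \<longrightarrow> (\<forall>z\<in>C (Suc n) \<inter> W. u - z \<in> C n)))" for n u
  have "cofinite_dim (G n u) \<and> (u \<in> A n \<longrightarrow> (\<forall>z\<in>C (Suc n) \<inter> G n u. u - z \<in> C n))" for n u
    unfolding G_def by (rule someI_ex) (rule ex_G)
  then have G: "\<And>n u. cofinite_dim (G n u)"
    "\<And>n u z. u \<in> A n \<Longrightarrow> z \<in> C (Suc n) \<Longrightarrow> z \<in> G n u \<Longrightarrow> u - z \<in> C n"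
    by blast+
  have "asymptotically_near (C 0) (9 / 8 + \<sigma> 0 / 2)"
    unfolding C_def using near \<sigma>[of 0] by (intro near_class_asymptotically_near) auto
  then have ex_H: "\<exists>W. cofinite_dim W \<and> (u \<in> C 0 \<longrightarrow> (\<forall>z\<in>C 0 \<inter> W. norm (u - z) \<le> 9 / 8 + \<sigma> 0 / 2))" for u
    using cofinite_dim_UNIV unfolding asymptotically_near_def by blast
  define H where "H u = (SOME W. cofinite_dim W \<and> (u \<in> C 0 \<longrightarrow> (\<forall>z\<in>C 0 \<inter> W. norm (u - z) \<le> 9 / 8 + \<sigma> 0 / 2)))" for u
  have "cofinite_dim (H u) \<and> (u \<in> C 0 \<longrightarrow> (\<forall>z\<in>C 0 \<inter> H u. norm (u - z) \<le> 9 / 8 + \<sigma> 0 / 2))" for u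
    unfolding H_def by (rule someI_ex) (rule ex_H)
  then have H: "\<And>u. cofinite_dim (H u)"
    "\<And>u z. u \<in> C 0 \<Longrightarrow> z \<in> C 0 \<Longrightarrow> z \<in> H u \<Longrightarrow> norm (u - z) \<le> 9 / 8 + \<sigma> 0 / 2"
    by blast+
  obtain N where N: "\<And>f :: 'a. cofinite_dim (N f)" "\<And>f z. z \<in> N f \<Longrightarrow> norm f \<le> norm (f + z)"
    using cofinite_dim_norm_le_add by metis
  \<comment> \<open>In \<open>(z, S, V)\<close>, \<open>z\<close> is the newest vector,
    \<open>S\<close> the alternating sum so far, and \<open>V\<close> contains all later vectors:
    \<open>G\<close> keeps sums in the classes, \<open>H\<close> bounds \<open>S\<close> minus a
    later vector, \<open>N\<close> keeps later vectors from shortening \<open>z\<close>.\<close>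
  define R where "R n = (\<lambda>(z, S, V). z \<in> A n \<and> cofinite_dim V \<and> V \<subseteq> G n z \<inter> H S \<inter> N z \<and>
      (n = 0 \<longrightarrow> S = z))" for n
  define R' where "R' n = (\<lambda>(z :: 'a, S, V) (z', S' :: 'a, V').
      z' \<in> V \<and> V' \<subseteq> V \<and> S' = S + (-1) ^ Suc n *\<^sub>R z')" for n :: nat
  have GHN: "cofinite_dim (G n z \<inter> H S \<inter> N z)" for n z S
    using G(1) H(1) N(1) by (intro cofinite_dim_Int)
  have "\<exists>f. \<forall>n. R n (f n) \<and> R' n (f n) (f (Suc n))"
  proof (rule dependent_nat_choice)
    obtain z where "z \<in> A 0"
      using pool[of "Suc 0"] cofinite_dim_UNIV unfolding A_def meets_cofinite_dim_def by blast
    then have "R 0 (z, z, G 0 z \<inter> H z \<inter> N z)"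
      using GHN by (auto simp: R_def)
    then show "\<exists>s. R 0 s" by blast
  next
    fix s n assume R: "R n s"
    obtain z S V where s: "s = (z, S, V)" by (cases s)
    have "cofinite_dim V"
      using R by (simp add: R_def s)
    then obtain z' where z': "z' \<in> A (Suc n)" "z' \<in> V"
      using pool[of "Suc (Suc n)"] unfolding A_def meets_cofinite_dim_def by blast
    define S' where "S' = S + (-1) ^ Suc n *\<^sub>R z'"
    have "R (Suc n) (z', S', V \<inter> (G (Suc n) z' \<inter> H S' \<inter> N z'))"
      using z' \<open>cofinite_dim V\<close> GHN by (auto simp: R_def intro: cofinite_dim_Int)
    then show "\<exists>s'. R (Suc n) s' \<and> R' n s s'"
      using z' by (intro exI) (auto simp: R'_def s S'_def)
  qed
  then obtain g where g: "\<And>n. R n (g n)" "\<And>n. R' n (g n) (g (Suc n))"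
    by blast
  define z where "z n = fst (g n)" for n
  define S where "S n = fst (snd (g n))" for n
  define V where "V n = snd (snd (g n))" for n
  have g_eq: "g n = (z n, S n, V n)" for n
    by (simp add: z_def S_def V_def)
  have z: "z n \<in> A n" and V: "cofinite_dim (V n)" "V n \<subseteq> G n (z n)" "V n \<subseteq> H (S n)" "V n \<subseteq> N (z n)" for n
    using g(1)[of n] by (auto simp: R_def g_eq)
  have z_Suc: "z (Suc n) \<in> V n" and V_Suc: "V (Suc n) \<subseteq> V n"
    and S_Suc: "S (Suc n) = S n + (-1) ^ Suc n *\<^sub>R z (Suc n)" for n
    using g(2)[of n] by (auto simp: R'_def g_eq)
  have V_mono: "V n \<subseteq> V m" if "m \<le> n" for m n
    by (rule lift_Suc_antimono_le[of V, OF _ that]) (use V_Suc in auto)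
  have z_V: "z n \<in> V m" if "m < n" for m n
    using that V_mono[of m "n - 1"] z_Suc[of "n - 1"] by (cases n) auto
  have subsp: "subspace (V n)" for n
    by (rule cofinite_dim_subspace[OF V(1)])
  \<comment> \<open>Sums starting at any index \<open>i\<close> are needed: membership in
    \<open>C i\<close> is proved by splitting off the first term, whereas \<open>S\<close> grows at
    its end.\<close>
  define y where "y i n = (\<Sum>j\<le>n. (-1) ^ j *\<^sub>R z (i + j))" for i n
  have y_0: "y i 0 = z i" for i
    by (simp add: y_def)
  have y_Suc: "y i (Suc n) = z i - y (Suc i) n" for i n
    unfolding y_def by (subst sum.atMost_Suc_shift) (simp add: sum_negf)
  have y_V: "y i n \<in> V j" if "j < i" for i j n
    unfolding y_def using that z_V by (intro subspace_sum subspace_scale subsp) auto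
  have y_C: "y i n \<in> C i" for i n
  proof (induction n arbitrary: i)
    case 0
    then show ?case using z A_C by (auto simp: y_0)
  next
    case (Suc n)
    have "y (Suc i) n \<in> G i (z i)"
      using y_V[of i "Suc i" n] V(2)[of i] by auto
    then show ?case
      using Suc z G(2) by (auto simp: y_Suc)
  qed
  have S_diff: "S n - S m \<in> V m" if "m \<le> n" for m n
    using that
  proof (induction n rule: dec_induct)
    case base
    then show ?case using subspace_0[OF subsp] by simp
  next
    case (step n)
    have "(S n - S m) + (-1) ^ Suc n *\<^sub>R z (Suc n) \<in> V m"
      using step z_V[of m "Suc n"] by (intro subspace_add subspace_scale subsp) auto
    then show ?case by (simp add: S_Suc algebra_simps)
  qed
  have "S 0 = z 0"
    using g(1)[of 0] by (simp add: R_def g_eq)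
  then have S_y: "S n = y 0 n" for n
    by (induction n) (auto simp: S_Suc y_def)
  \<comment> \<open>\<open>z (2 * k + 2)\<close> enters \<open>S (2 * k + 2)\<close> with sign +, so it has coefficient 2 in \<open>v l - v k\<close> for \<open>k < l\<close>.\<close>
  define v where "v k = S (2 * k + 1) - z (2 * k + 2)" for k
  have v_le: "norm (v k) \<le> 5 / 4" for k
  proof -
    have "z (2 * k + 2) \<in> C 0"
      using z A_C0 by blast
    moreover have "z (2 * k + 2) \<in> H (S (2 * k + 1))"
      using z_Suc[of "2 * k + 1"] V(3) by auto
    moreover have "S (2 * k + 1) \<in> C 0"
      using y_C S_y by simp
    ultimately have "norm (v k) \<le> 9 / 8 + \<sigma> 0 / 2"
      unfolding v_def by (intro H(2))
    with \<sigma>(2)[of 0] show ?thesis by simp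
  qed
  have v_ge: "2 \<le> norm (v k - v l)" if "k < l" for k l
  proof -
    let ?n = "2 * k + 2"
    \<comment> \<open>\<open>w\<close> collects the part of \<open>v l\<close> beyond index
      \<open>?n\<close>, so it lies in \<open>V ?n\<close>, and \<open>v l - v k\<close> is
      \<open>w\<close> plus twice the unit vector \<open>z ?n\<close>.\<close>
    define w where "w = S (2 * l + 1) - S ?n - z (2 * l + 2)"
    have "w \<in> V ?n"
      unfolding w_def using that by (intro subspace_diff subsp S_diff z_V) auto
    then have "(1 / 2) *\<^sub>R w \<in> N (z ?n)"
      using V(4)[of ?n] subspace_scale[OF subsp] by blast
    then have "norm (z ?n) \<le> norm (z ?n + (1 / 2) *\<^sub>R w)"
      by (rule N(2))
    moreover have "v l - v k = 2 *\<^sub>R (z ?n + (1 / 2) *\<^sub>R w)"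
      using S_Suc[of "2 * k + 1"] by (simp add: v_def w_def algebra_simps scaleR_2)
    moreover have "norm (z ?n) = 1"
      using z[of ?n] by (simp add: A_def)
    ultimately have "2 \<le> norm (v l - v k)"
      by simp
    then show ?thesis
      by (simp add: norm_minus_commute)
  qed
  have "norm ((4 / 5) *\<^sub>R v k) \<le> 1" for k
    using v_le[of k] by simp
  moreover have "8 / 5 \<le> norm ((4 / 5) *\<^sub>R v k - (4 / 5) *\<^sub>R v l)" if "k < l" for k l
    using v_ge[OF that] by (simp flip: scaleR_diff_right)
  ultimately show False
    using nosep by (auto dest!: spec[of _ "8 / 5"] spec[of _ "\<lambda>k. (4 / 5) *\<^sub>R v k"])
qed

section \<open>Almost isometric copies of the basis of the sequence space\<close>

lemma c0_norm_le:
  assumes "\<And>n. \<bar>Rep_c0 x n\<bar> \<le> c"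
  shows "norm x \<le> c"
  using assms by (auto simp: norm_c0.rep_eq intro: cSUP_least)

lemma c0_abs_le_norm: "\<bar>Rep_c0 x n\<bar> \<le> norm x"
proof -
  have "Bseq (Rep_c0 x)"
    using Rep_c0[of x] by (auto intro: convergent_imp_Bseq convergentI)
  then have "bdd_above (range (\<lambda>n. \<bar>Rep_c0 x n\<bar>))"
    unfolding Bseq_def by (auto intro: bdd_aboveI2)
  then show ?thesis
    unfolding norm_c0.rep_eq by (rule cSUP_upper[rotated]) simp
qed

lift_definition unit_c0 :: "nat \<Rightarrow> c0" is "\<lambda>n k. if k = n then 1 else 0"
proof -
  fix n :: nat
  have "\<forall>\<^sub>F k in sequentially. (if k = n then 1 else 0 :: real) = 0"
    using eventually_gt_at_top[of n] by eventually_elim simp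
  then show "(\<lambda>k. if k = n then 1 else 0 :: real) \<longlonglongrightarrow> 0"
    by (rule tendsto_eventually)
qed

lemma norm_unit_c0: "norm (unit_c0 n) = 1"
proof (rule antisym)
  show "norm (unit_c0 n) \<le> 1"
    by (rule c0_norm_le) (simp add: unit_c0.rep_eq)
  show "1 \<le> norm (unit_c0 n)"
    using c0_abs_le_norm[of "unit_c0 n" n] by (simp add: unit_c0.rep_eq)
qed

lemma Rep_c0_sum: "Rep_c0 (\<Sum>i\<in>A. a i *\<^sub>R x i) n = (\<Sum>i\<in>A. a i * Rep_c0 (x i) n)"
  by (induction A rule: infinite_finite_induct)
    (simp_all add: zero_c0.rep_eq plus_c0.rep_eq scaleR_c0.rep_eq)

text \<open>Continuity at 0 of \<open>S\<close> on the range of \<open>T\<close> gives the lower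
  bound, that of \<open>T\<close> the upper one, both by scaling.\<close>

lemma isomorphic_embedding_bounds:
  fixes T :: "'a::real_normed_vector \<Rightarrow> 'b::real_normed_vector"
  assumes "isomorphic_embedding T"
  obtains c C where "0 < c" "\<And>x. c * norm x \<le> norm (T x)" "\<And>x. norm (T x) \<le> C * norm x"
proof -
  obtain S where T: "linear T" and S: "homeomorphism UNIV (range T) T S"
    using assms by (auto simp: isomorphic_embedding_def)
  have T0: "T 0 = 0" using T by (rule linear_0)
  have ST: "S (T x) = x" for x
    using S by (simp add: homeomorphism_def)
  obtain d where d: "0 < d" "\<And>y. y \<in> range T \<Longrightarrow> norm y < d \<Longrightarrow> norm (S y) < 1"
  proof -
    have "continuous_on (range T) S"
      using S by (simp add: homeomorphism_def)
    then have "\<exists>d>0. \<forall>y\<in>range T. dist y 0 < d \<longrightarrow> dist (S y) (S 0) < 1"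
      unfolding continuous_on_iff using T0 by (metis rangeI zero_less_one)
    then show thesis
      using that ST[of 0] T0 by auto
  qed
  obtain e where e: "0 < e" "\<And>x. norm x < e \<Longrightarrow> norm (T x) < 1"
  proof -
    have "continuous_on UNIV T"
      using S by (simp add: homeomorphism_def)
    then have "\<exists>e>0. \<forall>x. dist x 0 < e \<longrightarrow> dist (T x) (T 0) < 1"
      unfolding continuous_on_iff by (metis UNIV_I zero_less_one)
    then show thesis
      using that T0 by auto
  qed
  have "d * norm x \<le> norm (T x)" for x
  proof (cases "x = 0")
    case False
    have "\<not> norm (T (x /\<^sub>R norm x)) < d"
      using d(2)[of "T (x /\<^sub>R norm x)"] False by (auto simp: ST)
    then show ?thesis
      using False by (simp add: linear_cmul[OF T] field_simps)
  qed (simp add: T0)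
  moreover have "norm (T x) \<le> 2 / e * norm x" for x
  proof (cases "x = 0")
    case False
    have "norm (T ((e / 2 / norm x) *\<^sub>R x)) < 1"
      using False e(1) by (intro e(2)) simp
    then show ?thesis
      using False e(1) by (simp add: linear_cmul[OF T] field_simps)
  qed (simp add: T0)
  ultimately show thesis
    using d(1) by (intro that)
qed

text \<open>At each coordinate at most one of the \<open>x i\<close> is nonzero, so the sum reduces
  to a single term there.\<close>

lemma c0_block_sum_bound:
  assumes A: "finite A" and a: "\<And>i. i \<in> A \<Longrightarrow> \<bar>a i\<bar> \<le> 1"
    and x: "\<And>i. norm (x i) \<le> 1"
    and disj: "\<And>i j k. i \<noteq> j \<Longrightarrow> Rep_c0 (x i) k = 0 \<or> Rep_c0 (x j) k = 0"
  shows "norm (\<Sum>i\<in>A. a i *\<^sub>R x i) \<le> 1"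
proof (rule c0_norm_le)
  fix k
  show "\<bar>Rep_c0 (\<Sum>i\<in>A. a i *\<^sub>R x i) k\<bar> \<le> 1"
  proof (cases "\<exists>i\<in>A. Rep_c0 (x i) k \<noteq> 0")
    case False
    then show ?thesis by (simp add: Rep_c0_sum)
  next
    case True
    then obtain i where i: "i \<in> A" "Rep_c0 (x i) k \<noteq> 0" by blast
    have "(\<Sum>j\<in>A. a j * Rep_c0 (x j) k) = (\<Sum>j\<in>A. if j = i then a i * Rep_c0 (x i) k else 0)"
      using disj i(2) by (intro sum.cong) auto
    then have "\<bar>Rep_c0 (\<Sum>i\<in>A. a i *\<^sub>R x i) k\<bar> = \<bar>a i\<bar> * \<bar>Rep_c0 (x i) k\<bar>"
      using A i(1) by (simp add: Rep_c0_sum abs_mult)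
    also have "\<dots> \<le> 1 * 1"
      using a[OF i(1)] c0_abs_le_norm[of "x i" k] x[of i] by (intro mult_mono) auto
    finally show ?thesis by simp
  qed
qed

text \<open>The \<open>u i\<close> are images of consecutive blocks on which the norm of \<open>T\<close> is nearly the limit of its norms on
  the tail subspaces.\<close>

lemma c0_james_distortion:
  fixes T :: "c0 \<Rightarrow> 'b::real_normed_vector"
  assumes T: "isomorphic_embedding T" and \<epsilon>: "0 < \<epsilon>"
  obtains u :: "nat \<Rightarrow> 'b"
  where "\<And>A a. finite A \<Longrightarrow> (\<And>i. i \<in> A \<Longrightarrow> \<bar>a i\<bar> \<le> 1) \<Longrightarrow> norm (\<Sum>i\<in>A. a i *\<^sub>R u i) \<le> 1 + \<epsilon>"
    and "\<And>i. 1 - \<epsilon> \<le> norm (u i)"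
proof -
  have lin: "linear T"
    using T by (simp add: isomorphic_embedding_def)
  obtain c C where c: "0 < c" "\<And>x. c * norm x \<le> norm (T x)" and C: "\<And>x. norm (T x) \<le> C * norm x"
    using isomorphic_embedding_bounds[OF T] by blast
  have "0 \<le> C"
    using C[of "unit_c0 0"] norm_ge_zero[of "T (unit_c0 0)"] by (simp only: norm_unit_c0)
  \<comment> \<open>Finite support lets the next block begin after the previous one ends.\<close>
  define F where "F n = {x. norm x \<le> 1 \<and> (\<forall>k<n. Rep_c0 x k = 0) \<and> (\<exists>m. \<forall>k\<ge>m. Rep_c0 x k = 0)}" for n
  define L where "L n = (SUP x\<in>F n. norm (T x))" for n
  have "unit_c0 n \<in> F n" for n
    by (auto simp: F_def norm_unit_c0 unit_c0.rep_eq intro: exI[of _ "Suc n"])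
  then have F_ne: "F n \<noteq> {}" for n
    by blast
  have "norm (T x) \<le> C" if "x \<in> F n" for x n
    using C[of x] mult_left_mono[of "norm x" 1 C] that \<open>0 \<le> C\<close> by (auto simp: F_def)
  then have bdd: "bdd_above ((\<lambda>x. norm (T x)) ` F n)" for n
    by (intro bdd_aboveI2) auto
  have L_ge: "norm (T x) \<le> L n" if "x \<in> F n" for x n
    unfolding L_def using that bdd by (rule cSUP_upper)
  have c_le: "c \<le> L n" for n
    using c(2)[of "unit_c0 n"] L_ge[OF \<open>unit_c0 n \<in> F n\<close>] by (simp add: norm_unit_c0)
  define \<Lambda> where "\<Lambda> = (INF n. L n)"
  have "0 < \<Lambda>"
    using c(1) cINF_greatest[of UNIV c L] c_le by (simp add: \<Lambda>_def)
  have \<Lambda>_le: "\<Lambda> \<le> L n" for n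
    unfolding \<Lambda>_def using c_le by (intro cINF_lower bdd_belowI2[of _ c]) auto
  have "\<Lambda> < \<Lambda> * (1 + \<epsilon>)"
    using \<open>0 < \<Lambda>\<close> \<epsilon> by simp
  \<comment> \<open>All blocks start beyond \<open>N\<close>, where the supremum already lies within
    the factor \<open>1 + \<epsilon>\<close> of \<open>\<Lambda>\<close>; their combinations stay in
    \<open>F N\<close> and inherit this bound.\<close>
  then obtain N where N: "L N < \<Lambda> * (1 + \<epsilon>)"
    unfolding \<Lambda>_def using cInf_lessD[of "range L"] by auto
  have blocks: "\<exists>x m. norm x \<le> 1 \<and> (\<forall>k. Rep_c0 x k \<noteq> 0 \<longrightarrow> n \<le> k \<and> k < m) \<and> n \<le> m \<and>
      \<Lambda> * (1 - \<epsilon>) < norm (T x)" for n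
  proof -
    have "\<Lambda> * (1 - \<epsilon>) < \<Lambda>"
      using \<open>0 < \<Lambda>\<close> \<epsilon> by simp
    also have "\<dots> \<le> L n" by (rule \<Lambda>_le)
    finally obtain x where x: "x \<in> F n" "\<Lambda> * (1 - \<epsilon>) < norm (T x)"
      unfolding L_def using less_cSUP_iff[OF F_ne bdd] by blast
    then obtain m where "\<And>k. m \<le> k \<Longrightarrow> Rep_c0 x k = 0"
      by (auto simp: F_def)
    moreover have "norm x \<le> 1" "\<And>k. k < n \<Longrightarrow> Rep_c0 x k = 0"
      using x(1) by (auto simp: F_def)
    ultimately show ?thesis
      using x(2) by (intro exI[of _ x] exI[of _ "max n m"]) (auto simp: less_max_iff_disj not_less[symmetric])
  qed
  define P where "P (k::nat) = (\<lambda>(x, n, m). norm x \<le> 1 \<and> (\<forall>k. Rep_c0 x k \<noteq> 0 \<longrightarrow> n \<le> k \<and> k < m) \<and> N \<le> n \<and> n \<le> m \<and>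
      \<Lambda> * (1 - \<epsilon>) < norm (T x))" for k
  define Q where "Q (k::nat) = (\<lambda>(x :: c0, n :: nat, m :: nat) (x' :: c0, n', m' :: nat). m \<le> n')" for k
  have "\<exists>f. \<forall>k. P k (f k) \<and> Q k (f k) (f (Suc k))"
  proof (rule dependent_nat_choice)
    show "\<exists>s. P 0 s"
      using blocks[of N] by (auto simp: P_def)
    show "\<exists>s'. P (Suc k) s' \<and> Q k s s'" if "P k s" for s k
    proof -
      obtain x n m where s: "s = (x, n, m)" by (cases s)
      obtain x' m' where "P (Suc k) (x', m, m')"
        using blocks[of m] \<open>P k s\<close> by (auto simp: P_def s)
      then show ?thesis
        by (intro exI[of _ "(x', m, m')"]) (auto simp: Q_def s)
    qed
  qed
  then obtain f where f: "\<And>k. P k (f k)" "\<And>k. Q k (f k) (f (Suc k))"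
    by blast
  define x where "x k = fst (f k)" for k
  define l where "l k = fst (snd (f k))" for k
  define r where "r k = snd (snd (f k))" for k
  have f_eq: "f k = (x k, l k, r k)" for k
    by (simp add: x_def l_def r_def)
  have x: "norm (x k) \<le> 1" "\<Lambda> * (1 - \<epsilon>) < norm (T (x k))"
    and supp: "\<And>j. Rep_c0 (x k) j \<noteq> 0 \<Longrightarrow> l k \<le> j \<and> j < r k" and lr: "N \<le> l k" "l k \<le> r k"
    and r_l: "r k \<le> l (Suc k)" for k
    using f[of k] by (auto simp: P_def Q_def f_eq)
  have "mono r"
    using r_l lr(2) by (intro incseq_SucI) (meson order_trans)
  then have r_le: "r i \<le> l j" if "i < j" for i j
    using r_l[of "j - 1"] monoD[of r i "j - 1"] that by (cases j) auto
  have disj: "Rep_c0 (x i) k = 0 \<or> Rep_c0 (x j) k = 0" if "i \<noteq> j" for i j k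
  proof (rule ccontr)
    assume "\<not> ?thesis"
    then have "l i \<le> k" "k < r i" "l j \<le> k" "k < r j"
      using supp by auto
    then show False
      using r_le[of i j] r_le[of j i] that by (cases i j rule: linorder_cases) auto
  qed
  define u where "u i = T (x i) /\<^sub>R \<Lambda>" for i
  show thesis
  proof
    fix A :: "nat set" and a :: "nat \<Rightarrow> real"
    assume A: "finite A" and a: "\<And>i. i \<in> A \<Longrightarrow> \<bar>a i\<bar> \<le> 1"
    let ?s = "\<Sum>i\<in>A. a i *\<^sub>R x i"
    have "norm ?s \<le> 1"
      using A a x(1) disj by (rule c0_block_sum_bound)
    moreover have "Rep_c0 ?s k = 0" if "k < N" for k
      unfolding Rep_c0_sum using supp lr(1) that by (intro sum.neutral) (metis mult_zero_right not_le order_trans)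
    \<comment> \<open>The sum of the right ends serves as a common bound for all supports.\<close>
    moreover have "Rep_c0 ?s k = 0" if "(\<Sum>i\<in>A. r i) \<le> k" for k
      unfolding Rep_c0_sum
    proof (rule sum.neutral, rule ballI)
      fix i assume "i \<in> A"
      then have "r i \<le> k"
        using member_le_sum[of i A r] A that by auto
      then show "a i * Rep_c0 (x i) k = 0"
        using supp[of i k] by auto
    qed
    ultimately have "?s \<in> F N"
      by (auto simp: F_def)
    then have "norm (T ?s) \<le> \<Lambda> * (1 + \<epsilon>)"
      using L_ge N by fastforce
    moreover have "(\<Sum>i\<in>A. a i *\<^sub>R u i) = T ?s /\<^sub>R \<Lambda>"
      by (simp add: u_def linear_sum[OF lin] linear_cmul[OF lin] scaleR_sum_right mult.commute)
    ultimately show "norm (\<Sum>i\<in>A. a i *\<^sub>R u i) \<le> 1 + \<epsilon>"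
      using \<open>0 < \<Lambda>\<close> by (simp add: field_simps)
  next
    show "1 - \<epsilon> \<le> norm (u i)" for i
      using x(2)[of i] \<open>0 < \<Lambda>\<close> by (simp add: u_def field_simps)
  qed
qed

text \<open>Flipping all signs except the one at \<open>k\<close> gives a second sum of norm at most \<open>1 + \<epsilon>\<close>; the two add up to
  \<open>2 * a k\<close> times \<open>u k\<close>.\<close>

lemma almost_c0_lower_bound:
  assumes upper: "\<And>A a. finite A \<Longrightarrow> (\<And>i. i \<in> A \<Longrightarrow> \<bar>a i\<bar> \<le> 1) \<Longrightarrow> norm (\<Sum>i\<in>A. a i *\<^sub>R u i) \<le> 1 + \<epsilon>"
    and lower: "1 - \<epsilon> \<le> norm (u k)"
    and A: "finite A" "k \<in> A" and a: "\<And>i. i \<in> A \<Longrightarrow> \<bar>a i\<bar> \<le> 1" "\<bar>a k\<bar> = 1"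
  shows "1 - 3 * \<epsilon> \<le> norm (\<Sum>i\<in>A. a i *\<^sub>R u i)"
proof -
  let ?b = "\<lambda>i. if i = k then a i else - a i"
  have "(\<Sum>i\<in>A. a i *\<^sub>R u i) + (\<Sum>i\<in>A. ?b i *\<^sub>R u i) = (\<Sum>i\<in>A. if i = k then (2 * a k) *\<^sub>R u k else 0)"
    unfolding sum.distrib[symmetric] by (rule sum.cong) (auto simp flip: scaleR_left_distrib)
  also have "\<dots> = (2 * a k) *\<^sub>R u k"
    using A by simp
  finally have "2 * norm (u k) = norm ((\<Sum>i\<in>A. a i *\<^sub>R u i) + (\<Sum>i\<in>A. ?b i *\<^sub>R u i))"
    using a(2) by (simp add: abs_mult)
  also have "\<dots> \<le> norm (\<Sum>i\<in>A. a i *\<^sub>R u i) + norm (\<Sum>i\<in>A. ?b i *\<^sub>R u i)"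
    by (rule norm_triangle_ineq)
  also have "norm (\<Sum>i\<in>A. ?b i *\<^sub>R u i) \<le> 1 + \<epsilon>"
    using A a(1) by (intro upper) auto
  finally show ?thesis
    using lower by simp
qed

text \<open>Choosing for each index a point of a countable dense set within
  \<open>\<delta> / 2\<close> is injective.\<close>

lemma uniformly_separated_imp_countable:
  fixes p :: "'i \<Rightarrow> 'b::metric_space"
  assumes sep: "separable_space (euclidean :: 'b topology)"
    and \<delta>: "0 < \<delta>" "\<And>i j. i \<noteq> j \<Longrightarrow> \<delta> \<le> dist (p i) (p j)"
  shows "countable (UNIV :: 'i set)"
proof -
  obtain D :: "'b set" where D: "countable D" "closure D = UNIV"
    using sep by (auto simp: separable_space_def)
  have "\<exists>d\<in>D. dist d (p i) < \<delta> / 2" for i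
    using D(2) \<delta>(1) closure_approachable[of "p i" D] by (metis UNIV_I half_gt_zero)
  then obtain h where h: "\<And>i. h i \<in> D" "\<And>i. dist (h i) (p i) < \<delta> / 2"
    by metis
  have "inj h"
  proof (rule injI, rule ccontr)
    fix i j assume "h i = h j" "i \<noteq> j"
    then show False
      using \<delta>(2)[of i j] h(2)[of i] h(2)[of j] dist_triangle_half_r[of "h i" "p i" \<delta> "p j"] by simp
  qed
  moreover have "countable (range h)"
    using D(1) h(1) by (auto intro: countable_subset)
  ultimately show ?thesis
    using countable_image_inj_on by blast
qed

section \<open>Extension of Hoelder maps\<close>

lemma uncountable_nat_set: "uncountable (UNIV :: nat set set)"
proof
  assume "countable (UNIV :: nat set set)"
  then have "range (from_nat_into UNIV) = (UNIV :: nat set set)"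
    by (intro range_from_nat_into) auto
  with Cantors_theorem[of "UNIV :: nat set"] show False
    by auto
qed

text \<open>A choice of signs is coded by the set of indices with sign +, so there are as many
  choices as elements of \<open>nat set\<close>.\<close>

definition signed_sum :: "(nat \<Rightarrow> 'b::real_vector) \<Rightarrow> nat set \<Rightarrow> nat \<Rightarrow> 'b"
  where "signed_sum u A n = (\<Sum>i\<le>n. (if i \<in> A then 1 else - 1) *\<^sub>R u i)"

lemma signed_sum_dist_le:
  assumes upper: "\<And>A a. finite A \<Longrightarrow> (\<And>i. i \<in> A \<Longrightarrow> \<bar>a i\<bar> \<le> 1) \<Longrightarrow> norm (\<Sum>i\<in>A. a i *\<^sub>R u i) \<le> 1 + \<epsilon>"
    and "m < n"
  shows "dist (signed_sum u A m) (signed_sum u A n) \<le> 1 + \<epsilon>"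
proof -
  have "{..n} = {..m} \<union> {m<..n}" "{..m} \<inter> {m<..n} = {}"
    using \<open>m < n\<close> by auto
  then have "signed_sum u A n - signed_sum u A m = (\<Sum>i\<in>{m<..n}. (if i \<in> A then 1 else - 1) *\<^sub>R u i)"
    by (simp add: signed_sum_def sum.union_disjoint)
  moreover have "norm (\<Sum>i\<in>{m<..n}. (if i \<in> A then 1 else - 1) *\<^sub>R u i) \<le> 1 + \<epsilon>"
    by (rule upper) auto
  ultimately show ?thesis
    by (metis dist_commute dist_norm)
qed

text \<open>Half the difference has coefficients in {-1, 0, 1}, with absolute value 1 at
  \<open>k\<close>, so the lower bound for almost isometric copies applies.\<close>

lemma signed_sum_dist_ge:
  assumes upper: "\<And>A a. finite A \<Longrightarrow> (\<And>i. i \<in> A \<Longrightarrow> \<bar>a i\<bar> \<le> 1) \<Longrightarrow> norm (\<Sum>i\<in>A. a i *\<^sub>R u i) \<le> 1 + \<epsilon>"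
    and lower: "\<And>i. 1 - \<epsilon> \<le> norm (u i)"
    and k: "k \<in> A \<longleftrightarrow> k \<notin> B"
  shows "2 * (1 - 3 * \<epsilon>) \<le> dist (signed_sum u A k) (signed_sum u B k)"
proof -
  define a :: "nat \<Rightarrow> real" where "a i = (if i \<in> A then 1 / 2 else - 1 / 2) - (if i \<in> B then 1 / 2 else - 1 / 2)" for i
  have "signed_sum u A k - signed_sum u B k = 2 *\<^sub>R (\<Sum>i\<le>k. a i *\<^sub>R u i)"
    unfolding signed_sum_def sum_subtractf[symmetric] scaleR_sum_right
    by (rule sum.cong) (auto simp: a_def simp flip: scaleR_left_distrib scaleR_left_diff_distrib)
  moreover have "1 - 3 * \<epsilon> \<le> norm (\<Sum>i\<le>k. a i *\<^sub>R u i)"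
    using upper lower[of k] by (rule almost_c0_lower_bound) (use k in \<open>auto simp: a_def\<close>)
  ultimately show ?thesis
    by (simp add: dist_norm)
qed

text \<open>On a \<open>b\<close>-separated set, distances of values up to \<open>r\<close> give the
  Hoelder constant \<open>r / b powr \<alpha>\<close>. As 0 is within distance 1 of every
  \<open>x n\<close>, the value of the extension at 0 serves as \<open>p\<close>.\<close>

lemma holder_extension_at_0:
  fixes x :: "nat \<Rightarrow> 'a::real_normed_vector" and y :: "nat \<Rightarrow> 'b::real_normed_vector"
  assumes \<alpha>: "\<alpha> \<in> holder_ext_exponents C (UNIV :: 'a set) (UNIV :: 'b set)" and C: "0 \<le> C"
    and b: "0 < b" and r: "0 < r" and x: "\<And>n. norm (x n) \<le> 1" "\<And>m n. m < n \<Longrightarrow> b \<le> norm (x m - x n)"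
    and y: "\<And>m n. m < n \<Longrightarrow> dist (y m) (y n) \<le> r"
  shows "\<exists>p. \<forall>n. dist p (y n) \<le> C * (r / b powr \<alpha>)"
proof -
  have "0 < \<alpha>" and ext: "\<And>K M (f :: 'a \<Rightarrow> 'b). 0 < K \<Longrightarrow> holder_on K \<alpha> M f \<Longrightarrow>
      \<exists>g. (\<forall>x\<in>M. g x = f x) \<and> holder_on (C * K) \<alpha> UNIV g"
    using \<alpha> unfolding holder_ext_exponents_def by simp_all
  have "x m \<noteq> x n" if "m < n" for m n
    using x(2)[OF that] b by auto
  then have "inj x"
    by (intro linorder_injI) auto
  define f where "f = y \<circ> inv x"
  define K where "K = r / b powr \<alpha>"
  have f_x: "f (x n) = y n" for n
    using \<open>inj x\<close> by (simp add: f_def)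
  have "0 < K"
    using r b by (simp add: K_def)
  have less: "dist (y m) (y n) \<le> K * dist (x m) (x n) powr \<alpha>" if "m < n" for m n
  proof -
    have "dist (y m) (y n) \<le> K * b powr \<alpha>"
      using y[OF that] b by (simp add: K_def)
    also have "\<dots> \<le> K * dist (x m) (x n) powr \<alpha>"
      using x(2)[OF that] b \<open>0 < K\<close> \<open>0 < \<alpha>\<close> by (intro mult_left_mono powr_mono2) (auto simp: dist_norm)
    finally show ?thesis .
  qed
  have "dist (y m) (y n) \<le> K * dist (x m) (x n) powr \<alpha>" for m n
    using less[of m n] less[of n m] by (cases m n rule: linorder_cases) (auto simp: dist_commute)
  then have "holder_on K \<alpha> (range x) f"
    by (auto simp: holder_on_def f_x)
  then obtain g where "\<forall>z\<in>range x. g z = f z" and holder: "holder_on (C * K) \<alpha> UNIV g"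
    using ext[OF \<open>0 < K\<close>] by blast
  then have g: "g (x n) = y n" for n
    by (simp add: f_x)
  have "dist (g 0) (y n) \<le> C * K" for n
  proof -
    have "dist (g 0) (y n) \<le> C * K * norm (x n) powr \<alpha>"
      using holder unfolding holder_on_def by (metis UNIV_I dist_0_norm g)
    also have "\<dots> \<le> C * K * 1 powr \<alpha>"
      using x(1)[of n] C \<open>0 < K\<close> \<open>0 < \<alpha>\<close> by (intro mult_left_mono powr_mono2) auto
    finally show ?thesis by simp
  qed
  then show ?thesis
    unfolding K_def by blast
qed

theorem theorem2p1:
  assumes "\<not> (\<exists>B :: 'a::real_normed_vector set. finite B \<and> span B = UNIV)"
    and "separable_space (euclidean :: 'b::banach topology)"
    and "\<exists>T :: c0 \<Rightarrow> 'b. isomorphic_embedding T"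
  shows "almost_isometric_ext_exponents (UNIV :: 'a set) (UNIV :: 'b set) = {}"
proof (rule equals0I)
  fix \<alpha> assume \<alpha>: "\<alpha> \<in> almost_isometric_ext_exponents (UNIV :: 'a set) (UNIV :: 'b set)"
  obtain b and x :: "nat \<Rightarrow> 'a" where b: "1 < b" and x: "\<And>n. norm (x n) \<le> 1"
    "\<And>m n. m < n \<Longrightarrow> b \<le> norm (x m - x n)"
    using elton_odell[OF assms(1)] by blast
  obtain T :: "c0 \<Rightarrow> 'b" where T: "isomorphic_embedding T"
    using assms(3) by blast
  \<comment> \<open>The instance C = 2 of the intersection suffices.\<close>
  have "0 < \<alpha>"
    using \<alpha> by (auto simp: almost_isometric_ext_exponents_def holder_ext_exponents_def dest: bspec[of _ _ 2])
  define q where "q = b powr \<alpha>"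
  have "1 < q"
    using b \<open>0 < \<alpha>\<close> by (simp add: q_def)
  \<comment> \<open>The factor 20 leaves room for \<open>(1 + \<epsilon>) * (1 + \<epsilon>) < (1 -
    3 * \<epsilon>) * q\<close>.\<close>
  define \<epsilon> where "\<epsilon> = min (q - 1) 1 / 20"
  have \<epsilon>: "0 < \<epsilon>" "\<epsilon> \<le> 1 / 20" "1 + 20 * \<epsilon> \<le> q"
    using \<open>1 < q\<close> by (auto simp: \<epsilon>_def min_def)
  \<comment> \<open>One factor \<open>1 + \<epsilon>\<close> is the loss in the extension, the other
    bounds the distances of the signed sums.\<close>
  define R where "R = (1 + \<epsilon>) * ((1 + \<epsilon>) / q)"
  have "R < 1 - 3 * \<epsilon>"
  proof -
    have "\<epsilon> * \<epsilon> \<le> \<epsilon> * (1 / 20)"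
      using \<epsilon> by (intro mult_left_mono) auto
    then have "(1 + \<epsilon>) * (1 + \<epsilon>) < (1 - 3 * \<epsilon>) * (1 + 20 * \<epsilon>)"
      using \<epsilon>(1) by (simp add: algebra_simps)
    also have "\<dots> \<le> (1 - 3 * \<epsilon>) * q"
      using \<epsilon> by (intro mult_left_mono) auto
    finally show ?thesis
      using \<open>1 < q\<close> by (simp add: R_def field_simps)
  qed
  obtain u :: "nat \<Rightarrow> 'b" where
    upper: "\<And>A a. finite A \<Longrightarrow> (\<And>i. i \<in> A \<Longrightarrow> \<bar>a i\<bar> \<le> 1) \<Longrightarrow> norm (\<Sum>i\<in>A. a i *\<^sub>R u i) \<le> 1 + \<epsilon>"
    and lower: "\<And>i. 1 - \<epsilon> \<le> norm (u i)"
    using c0_james_distortion[OF T \<epsilon>(1)] by blast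
  have "\<exists>p. \<forall>n. dist p (signed_sum u A n) \<le> R" for A
    unfolding R_def q_def
  proof (rule holder_extension_at_0[OF _ _ _ _ x])
    show "\<alpha> \<in> holder_ext_exponents (1 + \<epsilon>) (UNIV :: 'a set) (UNIV :: 'b set)"
      using \<alpha> \<epsilon>(1) by (simp add: almost_isometric_ext_exponents_def)
    show "dist (signed_sum u A m) (signed_sum u A n) \<le> 1 + \<epsilon>" if "m < n" for m n
      using upper that by (rule signed_sum_dist_le)
  qed (use b \<epsilon>(1) in auto)
  then obtain p where p: "\<And>A n. dist (p A) (signed_sum u A n) \<le> R"
    by metis
  have "2 * (1 - 3 * \<epsilon> - R) \<le> dist (p A) (p B)" if "A \<noteq> B" for A B
  proof -
    \<comment> \<open>At an index where the signs differ, the partial sums are almost 2 apart, while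
      \<open>p A\<close> and \<open>p B\<close> lie within \<open>R < 1 - 3 * \<epsilon>\<close> of
      them.\<close>
    obtain k where "k \<in> A \<longleftrightarrow> k \<notin> B"
      using \<open>A \<noteq> B\<close> by blast
    with upper lower have "2 * (1 - 3 * \<epsilon>) \<le> dist (signed_sum u A k) (signed_sum u B k)"
      by (rule signed_sum_dist_ge)
    then show ?thesis
      using p[of A k] p[of B k] dist_triangle[of "signed_sum u A k" "signed_sum u B k" "p A"]
        dist_triangle[of "p A" "signed_sum u B k" "p B"] by (simp add: dist_commute)
  qed
  then have "countable (UNIV :: nat set set)"
    using \<open>R < 1 - 3 * \<epsilon>\<close>
    by (intro uniformly_separated_imp_countable[OF assms(2), of "2 * (1 - 3 * \<epsilon> - R)" p]) auto
  with uncountable_nat_set show False by blast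
qed

end
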